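(* Let $\{\widetilde\Phi_t\}_{t\ge0}$ be the sequence of values of the Lyapunov function at the iterates generated by the DP-DT algorithm described in the context. Assume that the potential function is bounded from below, i.e. there is a constant $\widetilde\Phi_{\min}>-\infty$ with $\inf_{\mathbf w}\widetilde\Phi(\mathbf w)\ge\widetilde\Phi_{\min}$. Given the filtration $\mathcal F_t$ and the expected descent inequality $$\mathbb E[\widetilde\Phi_{t+1}\mid\mathcal F_t]\le\widetilde\Phi_t-\sum_{k=1}^KA_k^{(t)}\|\theta_k^{(t+1)}-\theta^{(t)}\|^2-B^{(t)}\,\mathbb E[\|\theta^{(t+1)}-\theta^{(t)}\|^2\mid\mathcal F_t]+C_{\rm residual}^{(t)}$$ with $A_k^{(t)},B^{(t)}>0$, the following hold: 1. $\{\widetilde\Phi_t\}_{t\ge0}$ converges almost surely to a finite random variable $\widetilde\Phi^*$ as $t\to\infty$. 2. The parameter updates are square-summable almost surely: $$\sum_{t=0}^\infty\|\theta^{(t+1)}-\theta^{(t)}\|^2<\infty\ \text{ a.s.,}\qquad \sum_{t=0}^\infty\|\theta_k^{(t+1)}-\theta_k^{(t)}\|^2<\infty\ \text{ a.s., for all }k\in\{1,\dots,K\}.$$ Consequently $\lim_{t\to\infty}\|\theta^{(t+1)}-\theta^{(t)}\|=0$ a.s. and $\lim_{t\to\infty}\|\theta_k^{(t+1)}-\theta_k^{(t)}\|=0$ a.s.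
   Context: DP-DT algorithm. Norms are Euclidean on $\mathbb R^d$. A training set $D_{\rm train}$ is split into mini-batches $D_1,\dots,D_M$, each $D_m$ into $K$ disjoint micro-batches $D_m^1,\dots,D_m^K$. $R(\theta;D)$ is the empirical risk (average loss) on $D$ and $R(\theta)=R(\theta;D_{\rm train})$; $r$ is a proper, lower semicontinuous convex regularizer. Iteration $t$ (using mini-batch $D_m$): (i) reset $\theta_k^{(t)}:=\theta^{(t)}$; (ii) $g_k^{(t)}=\nabla R(\theta_k^{(t)};D_m^k)+\pi_k^{(t)}$; $V_k^{(t)}$ diagonal, $0<V_k^{(t)}\le\tau^{-1}I$; $\widehat\pi_k^{(t)}=C^{(t)}\pi_k^{(t)}/\max\{C^{(t)},\|\pi_k^{(t)}\|\}$, with $C^{(t)}$ non-increasing clipping thresholds; $\eta_k^{(t)}$ is the largest $\eta\in[0,\eta_k]$ with $\|\widehat\pi_k^{(t)}-2\rho_k^{(t)}\eta V_k^{(t)}g_k^{(t)}\|\le C^{(t)}$; (iii) $\theta_k^{(t+1)}=\theta_k^{(t)}-\eta_k^{(t)}V_k^{(t)}g_k^{(t)}$, $\pi_k^{(t+1)}=\widehat\pi_k^{(t)}+\rho_k^{(t)}(\theta_k^{(t+1)}-\theta^{(t)})$; (iv) $\theta^{(t+1)}=\mathrm{Prox}_{\widehat\eta^{(t)},r}(\theta^{(t)}-\widehat\eta^{(t)}(\nabla h(\theta^{(t)})+z^{(t)}))$, $z^{(t)}\sim N(0,\sigma_{\rm noise}^2I)$, $h(\theta)=\frac1K\sum_k[\langle\pi_k^{(t+1)},\theta_k^{(t+1)}-\theta\rangle+\frac{\rho_k^{(t)}}2\|\theta_k^{(t+1)}-\theta\|^2]$,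 $\widehat\eta^{(t)}=K\eta_\theta/\sum_k\rho_k^{(t)}$, $\mathrm{Prox}_{\eta,r}(v)=\arg\min_u\{r(u)+\frac1{2\eta}\|u-v\|^2\}$; (v) $\rho_k^{(t+1)}=\rho_k^{(t)}/\gamma_k$, the penalties growing geometrically in the convergence analysis. In $\|\theta_k^{(t+1)}-\theta_k^{(t)}\|$, $\theta_k^{(t)}$ is the reset value $\theta^{(t)}$. $\mathcal F_t$ is the filtration generated by the algorithm up to iteration $t$ (before $z^{(t)}$ is drawn). Augmented Lagrangian: $\mathcal L(\theta,\{\theta_k\},\{\pi_k\},\{\rho_k\})=\frac1{MK}\sum_{m=1}^M\sum_{k=1}^KR(\theta_k;D_m^k)+r(\theta)+\frac1K\sum_k[\langle\pi_k,\theta_k-\theta\rangle+\frac{\rho_k}2\|\theta_k-\theta\|^2]$. Let $\mathbf w^{(t+1)}=(\{\theta_k^{(t+1)}\},\theta^{(t+1)},\{\pi_k^{(t+1)}\},\{\rho_k^{(t+1)}\})$ collect the values after the $t$-th iteration. Let $L$ be the smoothness constant of $R$, $\zeta$ a uniform bound on $\|\nabla R(\theta_k^{(t)};D_m^k)-\nabla R(\theta_k^{(t)};D_{\rm train})\|$, $c_k^{(t)}=\tau/\eta_k^{(t)}-(L+\rho_k^{(t)})/2$, $c_{\rm aux}^{(t)}=\min_kc_k^{(t)}$. The Lyapunov function is $\widetilde\Phi_{t+1}=\widetilde\Phi(\mathbf w^{(t+1)})=\mathcal L(\mathbf w^{(t+1)})+\sum_{i=t}^\infty\zeta^2/(2c_{\rm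 aux}^{(i)})$ (for $\widetilde\Phi_0$ the nonexistent term $i=-1$ is dropped). $A_k^{(t)}=\frac1K(\frac{c_k^{(t)}}2-\rho_k^{(t)}-\frac12)$, $B^{(t)}=\frac1{\widehat\eta^{(t)}}-\frac{L_h}2$, $L_h=\frac1K\sum_k\rho_k^{(t)}$. $C_{\rm residual}^{(t)}=\mathbb E[G^{(t)}\mid\mathcal F_t]+(\widehat\eta^{(t)})^2d\sigma_{\rm noise}^2+\sum_{k=1}^K\|\kappa_k^{(t)}\|^2/(2K)$, where $\kappa_k^{(t)}=\pi_k^{(t)}-\widehat\pi_k^{(t)}$ and $G^{(t)}$ is the reset error: $\mathcal L$ at $(\theta^{(t+1)},\{\theta_k=\theta^{(t+1)}\},\{\pi_k^{(t+1)}\})$ minus $\mathcal L$ at $(\theta^{(t+1)},\{\theta_k^{(t+1)}\},\{\pi_k^{(t+1)}\})$, with penalties $\rho_k^{(t)}$. *)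

theory Defs
  imports "HOL-Probability.Probability"
begin

section \<open>Gradients, regularizers, proximal points, Gaussian noise\<close>

definition gradient :: "('a::real_inner \<Rightarrow> real) \<Rightarrow> 'a \<Rightarrow> 'a" where
  "gradient f x = (THE D. GDERIV f x :> D)"

definition proper_lsc_convex :: "('a::real_normed_vector \<Rightarrow> ereal) \<Rightarrow> bool" where
  "proper_lsc_convex r \<longleftrightarrow>
     (\<forall>x. r x \<noteq> -\<infinity>) \<and> (\<exists>x. r x \<noteq> \<infinity>) \<and>
     (\<forall>x. r x \<le> Liminf (at x) r) \<and>
     (\<forall>x y. \<forall>u\<in>{0<..<1}.
        r ((1 - u) *\<^sub>R x + u *\<^sub>R y) \<le> ereal (1 - u) * r x + ereal u * r y)"

text \<open>
  \<open>p = Prox v\<close> for the step size \<open>\<eta>\<close> and the regularizer \<open>r\<close>. As a relation: the minimizer exists and is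
  unique whenever \<open>\<eta> > 0\<close> and \<open>r\<close> is proper, lower semicontinuous and convex.
\<close>
definition is_prox :: "real \<Rightarrow> ('a::real_normed_vector \<Rightarrow> ereal) \<Rightarrow> 'a \<Rightarrow> 'a \<Rightarrow> bool" where
  "is_prox \<eta> r v p \<longleftrightarrow>
     is_arg_min (\<lambda>u. r u + ereal (1 / (2 * \<eta>) * (norm (u - v))\<^sup>2)) (\<lambda>_. True) p"

text \<open>\<open>N(0, \<sigma>\<^sup>2 I)\<close>, as the image of the standard Gaussian under scaling, so that \<open>\<sigma> = 0\<close> is included.\<close>
definition isotropic_gaussian :: "real \<Rightarrow> (real^'d::finite) measure" where
  "isotropic_gaussian \<sigma> =
     distr (density lborel (\<lambda>x. ennreal (\<Prod>i\<in>UNIV. std_normal_density (x $ i)))) borel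
       (\<lambda>x. \<sigma> *\<^sub>R x)"

definition preimages :: "'w measure \<Rightarrow> ('w \<Rightarrow> 'b::topological_space) \<Rightarrow> 'w set set" where
  "preimages W f = {f -` A \<inter> space W | A. A \<in> sets borel}"


section \<open>Data of the problem and hyperparameters\<close>

text \<open>
  Elements of \<open>'x\<close> are (indices of) training examples. Mini-batches are numbered by \<open>m \<in> {1..n_mini P}\<close>,
  micro-batches and local models by \<open>k \<in> {1..n_micro P}\<close>; \<open>micro P m k\<close> is \<open>D\<^sub>m\<^sup>k\<close>.
\<close>
record ('d::finite, 'x) dpdt_problem =
  loss :: "real^'d \<Rightarrow> 'x \<Rightarrow> real"
  train :: "'x set"
  n_mini :: nat
  n_micro :: nat
  micro :: "nat \<Rightarrow> nat \<Rightarrow> 'x set"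
  reg :: "real^'d \<Rightarrow> ereal"
  tau :: real
  local_rate :: "nat \<Rightarrow> real"    \<comment> \<open>\<open>\<eta>\<^sub>k\<close>\<close>
  global_rate :: real            \<comment> \<open>\<open>\<eta>\<^sub>\<theta>\<close>\<close>
  penalty0 :: "nat \<Rightarrow> real"      \<comment> \<open>\<open>\<rho>\<^sub>k\<close> at iteration 0\<close>
  gam :: "nat \<Rightarrow> real"           \<comment> \<open>\<open>\<gamma>\<^sub>k\<close>\<close>
  clip :: "nat \<Rightarrow> real"          \<comment> \<open>\<open>C\<close>, by iteration\<close>
  noise_sd :: real

definition risk :: "('d::finite, 'x) dpdt_problem \<Rightarrow> 'x set \<Rightarrow> real^'d \<Rightarrow> real" where
  "risk P D \<theta> = (\<Sum>x\<in>D. loss P \<theta> x) / real (card D)"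

text \<open>\<open>gam P k < 1\<close> makes the penalties grow geometrically.\<close>
definition dpdt_problem_ok :: "('d::finite, 'x) dpdt_problem \<Rightarrow> bool" where
  "dpdt_problem_ok P \<longleftrightarrow>
     n_mini P \<ge> 1 \<and> n_micro P \<ge> 1 \<and> finite (train P) \<and>
     (\<forall>m\<in>{1..n_mini P}. \<forall>k\<in>{1..n_micro P}. micro P m k \<noteq> {}) \<and>
     disjoint_family_on (\<lambda>(m, k). micro P m k) ({1..n_mini P} \<times> {1..n_micro P}) \<and>
     train P = (\<Union>m\<in>{1..n_mini P}. \<Union>k\<in>{1..n_micro P}. micro P m k) \<and>
     (\<forall>m\<in>{1..n_mini P}. \<forall>k\<in>{1..n_micro P}. \<forall>\<theta>. risk P (micro P m k) differentiable at \<theta>) \<and>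
     proper_lsc_convex (reg P) \<and>
     tau P > 0 \<and> global_rate P > 0 \<and> noise_sd P \<ge> 0 \<and>
     (\<forall>k\<in>{1..n_micro P}. penalty0 P k > 0 \<and> 0 < gam P k \<and> gam P k < 1) \<and>
     (\<forall>t. clip P t > 0) \<and> antimono (clip P)"

primrec penalty :: "('d::finite, 'x) dpdt_problem \<Rightarrow> nat \<Rightarrow> nat \<Rightarrow> real" where
  "penalty P 0 k = penalty0 P k"
| "penalty P (Suc t) k = penalty P t k / gam P k"

definition eta_hat :: "('d::finite, 'x) dpdt_problem \<Rightarrow> nat \<Rightarrow> real" where
  "eta_hat P t = real (n_micro P) * global_rate P / (\<Sum>k=1..n_micro P. penalty P t k)"

definition aug_lagrangian ::
  "('d::finite, 'x) dpdt_problem \<Rightarrow> real^'d \<Rightarrow> (nat \<Rightarrow> real^'d) \<Rightarrow> (nat \<Rightarrow> real^'d) \<Rightarrow> (nat \<Rightarrow> real) \<Rightarrow> ereal"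
where
  "aug_lagrangian P \<theta> \<theta>s \<pi>s \<rho>s =
     ereal ((\<Sum>m=1..n_mini P. \<Sum>k=1..n_micro P. risk P (micro P m k) (\<theta>s k))
              / (real (n_mini P) * real (n_micro P)))
     + reg P \<theta>
     + ereal ((\<Sum>k=1..n_micro P. \<pi>s k \<bullet> (\<theta>s k - \<theta>) + \<rho>s k / 2 * (norm (\<theta>s k - \<theta>))\<^sup>2)
              / real (n_micro P))"


section \<open>Runs of the algorithm\<close>

text \<open>
  All quantities are random variables on a space \<open>'w\<close>; the first argument is the iteration.
  \<open>loc X (Suc t) k\<close> is the local model produced by iteration \<open>t\<close>, before it is reset; the reset value
  at the start of iteration \<open>t\<close> is \<open>glob X t\<close>. \<open>batch X t\<close> is the number of the mini-batch used,
  \<open>precond X t k\<close> the diagonal of \<open>V\<^sub>k\<close>.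
\<close>
record ('w, 'd::finite) dpdt_run =
  glob :: "nat \<Rightarrow> 'w \<Rightarrow> real^'d"
  loc :: "nat \<Rightarrow> nat \<Rightarrow> 'w \<Rightarrow> real^'d"
  dual :: "nat \<Rightarrow> nat \<Rightarrow> 'w \<Rightarrow> real^'d"
  precond :: "nat \<Rightarrow> nat \<Rightarrow> 'w \<Rightarrow> real^'d"
  step :: "nat \<Rightarrow> nat \<Rightarrow> 'w \<Rightarrow> real"
  batch :: "nat \<Rightarrow> 'w \<Rightarrow> nat"
  noise :: "nat \<Rightarrow> 'w \<Rightarrow> real^'d"

text \<open>Everything determined up to iteration \<open>t\<close>, except \<open>noise X t\<close> and hence \<open>glob X (Suc t)\<close>.\<close>
definition history ::
  "'w measure \<Rightarrow> ('d::finite, 'x) dpdt_problem \<Rightarrow> ('w, 'd) dpdt_run \<Rightarrow> nat \<Rightarrow> 'w measure"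
where
  "history W P X t = sigma (space W)
     ((\<Union>s\<in>{..t}. preimages W (glob X s) \<union> preimages W (batch X s)
         \<union> (\<Union>k\<in>{1..n_micro P}. preimages W (precond X s k) \<union> preimages W (step X s k)))
      \<union> (\<Union>s\<in>{..Suc t}. \<Union>k\<in>{1..n_micro P}. preimages W (loc X s k) \<union> preimages W (dual X s k))
      \<union> (\<Union>s\<in>{..<t}. preimages W (noise X s)))"

definition clipped_dual ::
  "('d::finite, 'x) dpdt_problem \<Rightarrow> ('w, 'd) dpdt_run \<Rightarrow> nat \<Rightarrow> nat \<Rightarrow> 'w \<Rightarrow> real^'d" where
  "clipped_dual P X t k \<omega> = (clip P t / max (clip P t) (norm (dual X t k \<omega>))) *\<^sub>R dual X t k \<omega>"

definition local_grad ::
  "('d::finite, 'x) dpdt_problem \<Rightarrow> ('w, 'd) dpdt_run \<Rightarrow> nat \<Rightarrow> nat \<Rightarrow> 'w \<Rightarrow> real^'d" where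
  "local_grad P X t k \<omega> =
     gradient (risk P (micro P (batch X t \<omega>) k)) (glob X t \<omega>) + dual X t k \<omega>"

definition local_dir ::
  "('d::finite, 'x) dpdt_problem \<Rightarrow> ('w, 'd) dpdt_run \<Rightarrow> nat \<Rightarrow> nat \<Rightarrow> 'w \<Rightarrow> real^'d" where
  "local_dir P X t k \<omega> = (\<chi> i. precond X t k \<omega> $ i * local_grad P X t k \<omega> $ i)"

definition admissible_steps ::
  "('d::finite, 'x) dpdt_problem \<Rightarrow> ('w, 'd) dpdt_run \<Rightarrow> nat \<Rightarrow> nat \<Rightarrow> 'w \<Rightarrow> real set" where
  "admissible_steps P X t k \<omega> =
     {\<eta>\<in>{0..local_rate P k}.
        norm (clipped_dual P X t k \<omega> - (2 * penalty P t k * \<eta>) *\<^sub>R local_dir P X t k \<omega>) \<le> clip P t}"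

definition surrogate ::
  "('d::finite, 'x) dpdt_problem \<Rightarrow> ('w, 'd) dpdt_run \<Rightarrow> nat \<Rightarrow> 'w \<Rightarrow> real^'d \<Rightarrow> real" where
  "surrogate P X t \<omega> \<theta> =
     (\<Sum>k=1..n_micro P. dual X (Suc t) k \<omega> \<bullet> (loc X (Suc t) k \<omega> - \<theta>)
         + penalty P t k / 2 * (norm (loc X (Suc t) k \<omega> - \<theta>))\<^sup>2) / real (n_micro P)"

definition dpdt_algorithm ::
  "'w measure \<Rightarrow> ('d::finite, 'x) dpdt_problem \<Rightarrow> ('w, 'd) dpdt_run \<Rightarrow> bool" where
  "dpdt_algorithm W P X \<longleftrightarrow>
     (\<forall>t. glob X t \<in> borel_measurable W \<and> noise X t \<in> borel_measurable W
          \<and> batch X t \<in> borel_measurable W) \<and>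
     (\<forall>t. \<forall>k\<in>{1..n_micro P}. loc X t k \<in> borel_measurable W \<and> dual X t k \<in> borel_measurable W
          \<and> precond X t k \<in> borel_measurable W \<and> step X t k \<in> borel_measurable W) \<and>
     (\<forall>t. distr W borel (noise X t) = isotropic_gaussian (noise_sd P)
          \<and> prob_space.indep_set W (sets (history W P X t)) (preimages W (noise X t))) \<and>
     (\<forall>\<omega>\<in>space W. \<forall>k\<in>{1..n_micro P}. loc X 0 k \<omega> = glob X 0 \<omega>) \<and>
     (\<forall>\<omega>\<in>space W. \<forall>t. batch X t \<omega> \<in> {1..n_mini P}) \<and>
     (\<forall>\<omega>\<in>space W. \<forall>t. \<forall>k\<in>{1..n_micro P}.
        (\<forall>i. 0 < precond X t k \<omega> $ i \<and> precond X t k \<omega> $ i \<le> 1 / tau P) \<and>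
        step X t k \<omega> \<in> admissible_steps P X t k \<omega> \<and>
        (\<forall>\<eta>\<in>admissible_steps P X t k \<omega>. \<eta> \<le> step X t k \<omega>) \<and>
        loc X (Suc t) k \<omega> = glob X t \<omega> - step X t k \<omega> *\<^sub>R local_dir P X t k \<omega> \<and>
        dual X (Suc t) k \<omega> =
          clipped_dual P X t k \<omega> + penalty P t k *\<^sub>R (loc X (Suc t) k \<omega> - glob X t \<omega>)) \<and>
     (\<forall>\<omega>\<in>space W. \<forall>t.
        is_prox (eta_hat P t) (reg P)
          (glob X t \<omega> - eta_hat P t *\<^sub>R (gradient (surrogate P X t \<omega>) (glob X t \<omega>) + noise X t \<omega>))
          (glob X (Suc t) \<omega>))"


section \<open>Lyapunov function and constants of the descent inequality\<close>

text \<open>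
  In the definitions below \<open>L\<close> is the smoothness constant and \<open>\<zeta>\<close> the gradient dissimilarity bound.
  \<open>c_coef\<close> is only meaningful for \<open>step X t k \<omega> > 0\<close>; for step 0 the convention \<open>x / 0 = 0\<close> makes
  \<open>c_coef\<close> and \<open>A_coef\<close> negative (given \<open>L \<ge> 0\<close>), so \<open>A_coef > 0\<close> includes \<open>step > 0\<close>.
\<close>
definition c_coef ::
  "('d::finite, 'x) dpdt_problem \<Rightarrow> ('w, 'd) dpdt_run \<Rightarrow> real \<Rightarrow> nat \<Rightarrow> nat \<Rightarrow> 'w \<Rightarrow> real" where
  "c_coef P X L t k \<omega> = tau P / step X t k \<omega> - (L + penalty P t k) / 2"

definition c_aux ::
  "('d::finite, 'x) dpdt_problem \<Rightarrow> ('w, 'd) dpdt_run \<Rightarrow> real \<Rightarrow> nat \<Rightarrow> 'w \<Rightarrow> real" where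
  "c_aux P X L t \<omega> = Min ((\<lambda>k. c_coef P X L t k \<omega>) ` {1..n_micro P})"

text \<open>
  The tail in \<open>lyapunov \<dots> t\<close> starts at \<open>i = t - 1\<close>; for \<open>t = 0\<close> truncated subtraction on \<open>nat\<close> drops the
  term \<open>i = -1\<close>.
\<close>
definition lyapunov ::
  "('d::finite, 'x) dpdt_problem \<Rightarrow> ('w, 'd) dpdt_run \<Rightarrow> real \<Rightarrow> real \<Rightarrow> nat \<Rightarrow> 'w \<Rightarrow> ereal" where
  "lyapunov P X L \<zeta> t \<omega> =
     aug_lagrangian P (glob X t \<omega>) (\<lambda>k. loc X t k \<omega>) (\<lambda>k. dual X t k \<omega>) (penalty P t)
     + ereal (\<Sum>i. \<zeta>\<^sup>2 / (2 * c_aux P X L ((t - 1) + i) \<omega>))"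

definition A_coef ::
  "('d::finite, 'x) dpdt_problem \<Rightarrow> ('w, 'd) dpdt_run \<Rightarrow> real \<Rightarrow> nat \<Rightarrow> nat \<Rightarrow> 'w \<Rightarrow> real" where
  "A_coef P X L t k \<omega> = 1 / real (n_micro P) * (c_coef P X L t k \<omega> / 2 - penalty P t k - 1 / 2)"

definition B_coef :: "('d::finite, 'x) dpdt_problem \<Rightarrow> nat \<Rightarrow> real" where
  "B_coef P t = 1 / eta_hat P t - ((\<Sum>k=1..n_micro P. penalty P t k) / real (n_micro P)) / 2"

text \<open>Both Lagrangians below are finite, since \<open>reg P\<close> is finite at a proximal point.\<close>
definition reset_error ::
  "('d::finite, 'x) dpdt_problem \<Rightarrow> ('w, 'd) dpdt_run \<Rightarrow> nat \<Rightarrow> 'w \<Rightarrow> real" where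
  "reset_error P X t \<omega> = real_of_ereal
     (aug_lagrangian P (glob X (Suc t) \<omega>) (\<lambda>k. glob X (Suc t) \<omega>)
        (\<lambda>k. dual X (Suc t) k \<omega>) (penalty P t)
      - aug_lagrangian P (glob X (Suc t) \<omega>) (\<lambda>k. loc X (Suc t) k \<omega>)
        (\<lambda>k. dual X (Suc t) k \<omega>) (penalty P t))"

definition C_residual ::
  "'w measure \<Rightarrow> ('d::finite, 'x) dpdt_problem \<Rightarrow> ('w, 'd) dpdt_run \<Rightarrow> nat \<Rightarrow> 'w \<Rightarrow> real" where
  "C_residual W P X t \<omega> =
     real_cond_exp W (history W P X t) (reset_error P X t) \<omega>
     + (eta_hat P t)\<^sup>2 * real CARD('d) * (noise_sd P)\<^sup>2
     + (\<Sum>k=1..n_micro P. (norm (dual X t k \<omega> - clipped_dual P X t k \<omega>))\<^sup>2) / (2 * real (n_micro P))"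

text \<open>
  \<open>real_of_ereal\<close> loses nothing: \<open>lyapunov \<dots> (Suc t)\<close> is finite because \<open>glob X (Suc t)\<close> is a proximal
  point. Only \<open>lyapunov \<dots> 0\<close> can be infinite, and the inequality is then trivial for \<open>t = 0\<close>.
\<close>
definition expected_descent ::
  "'w measure \<Rightarrow> ('d::finite, 'x) dpdt_problem \<Rightarrow> ('w, 'd) dpdt_run \<Rightarrow> real \<Rightarrow> real \<Rightarrow> nat \<Rightarrow> 'w \<Rightarrow> bool" where
  "expected_descent W P X L \<zeta> t \<omega> \<longleftrightarrow>
     ereal (real_cond_exp W (history W P X t)
              (\<lambda>\<omega>'. real_of_ereal (lyapunov P X L \<zeta> (Suc t) \<omega>')) \<omega>)
     \<le> lyapunov P X L \<zeta> t \<omega>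
       - ereal (\<Sum>k=1..n_micro P. A_coef P X L t k \<omega> * (norm (loc X (Suc t) k \<omega> - glob X t \<omega>))\<^sup>2)
       - ereal (B_coef P t * real_cond_exp W (history W P X t)
                  (\<lambda>\<omega>'. (norm (glob X (Suc t) \<omega>' - glob X t \<omega>'))\<^sup>2) \<omega>)
       + ereal (C_residual W P X t \<omega>)"

end

theory Submission
  imports Defs
begin

text \<open>
  Convergence holds path by path. The clipping rule bounds the dual variables and makes the local updates \<open>O(1 / \<rho>)\<close>. A global update is a
  proximal step of length \<open>O(1 / \<rho>)\<close> along a bounded gradient plus noise. Since the subdifferential
  of the regularizer is monotone, the subgradients selected by the proximal map grow no faster than the
  partial sums of the noise, and by the finite first moment of the Gaussian the noise almost surely
  grows slower than any prescribed geometric sequence. As the penalties \<open>\<rho>\<close> grow geometrically, all updates, the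
  increments of the regularizer and the penalty terms decay geometrically, so the augmented Lagrangian
  converges; the tail in the Lyapunov function tends to 0.
\<close>

section \<open>Proximal points and Gaussian noise\<close>

lemma gradient_eqI:
  assumes "GDERIV f x :> D"
  shows "gradient f x = D"
  unfolding gradient_def
proof (rule the_equality)
  fix D' assume "GDERIV f x :> D'"
  with assms have "(\<lambda>h. h \<bullet> D') = (\<lambda>h. h \<bullet> D)"
    unfolding gderiv_def by (rule has_derivative_unique[rotated])
  then have "(D' - D) \<bullet> (D' - D) = 0"
    by (metis inner_diff_right right_minus_eq)
  then show "D' = D" by simp
qed (fact assms)

lemma gradient_surrogate:
  "gradient (surrogate P X t \<omega>) \<theta> =
     - (\<Sum>k=1..n_micro P. dual X (Suc t) k \<omega> + penalty P t k *\<^sub>R (loc X (Suc t) k \<omega> - \<theta>)) /\<^sub>R real (n_micro P)"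
proof (rule gradient_eqI)
  let ?D = "- (\<Sum>k=1..n_micro P. dual X (Suc t) k \<omega> + penalty P t k *\<^sub>R (loc X (Suc t) k \<omega> - \<theta>)) /\<^sub>R real (n_micro P)"
  have "((\<lambda>\<theta>. dual X (Suc t) k \<omega> \<bullet> (loc X (Suc t) k \<omega> - \<theta>)
         + penalty P t k / 2 * (norm (loc X (Suc t) k \<omega> - \<theta>))\<^sup>2) has_derivative
         (\<lambda>h. - (h \<bullet> (dual X (Suc t) k \<omega> + penalty P t k *\<^sub>R (loc X (Suc t) k \<omega> - \<theta>))))) (at \<theta>)" for k
    unfolding power2_norm_eq_inner
    by ((rule derivative_eq_intros refl)+) (auto simp: fun_eq_iff inner_add_right inner_diff_right inner_diff_left inner_commute right_diff_distrib)
  then have "(surrogate P X t \<omega> has_derivative (\<lambda>h. (\<Sum>k=1..n_micro P. - (h \<bullet> (dual X (Suc t) k \<omega> + penalty P t k *\<^sub>R (loc X (Suc t) k \<omega> - \<theta>)))) / real (n_micro P))) (at \<theta>)"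
    unfolding surrogate_def divide_inverse by (intro has_derivative_mult_left has_derivative_sum)
  then show "GDERIV (surrogate P X t \<omega>) \<theta> :> ?D"
    unfolding gderiv_def by (simp add: inner_sum_right sum_negf divide_inverse mult.commute)
qed

text \<open>All superlevel sets are open: \<open>Liminf (at x) r\<close> sees only punctured
  neighbourhoods of \<open>x\<close>, and the point \<open>x\<close> itself is added by hand. This
  makes the regularizer Borel.\<close>

lemma lsc_borel_measurable:
  fixes r :: "'a::topological_space \<Rightarrow> ereal"
  assumes "\<And>x. r x \<le> Liminf (at x) r"
  shows "r \<in> borel_measurable borel"
proof (rule borel_measurableI_greater)
  fix a
  have "open {x. a < r x}"
  proof (subst open_subopen, intro ballI)
    fix x assume x: "x \<in> {x. a < r x}"
    then have "eventually (\<lambda>y. a < r y) (at x)"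
      using assms[of x] unfolding le_Liminf_iff by auto
    with x have "eventually (\<lambda>y. a < r y) (nhds x)"
      by (auto simp: eventually_at_filter elim: eventually_mono)
    then show "\<exists>T. open T \<and> x \<in> T \<and> T \<subseteq> {x. a < r x}"
      unfolding eventually_nhds by auto
  qed
  then show "{x \<in> space borel. a < r x} \<in> sets borel" by simp
qed

text \<open>Comparing the proximal objective at \<open>p\<close> with its value at a point where
  \<open>r\<close> is finite excludes \<open>\<infinity>\<close>; properness excludes
  \<open>-\<infinity>\<close>.\<close>

lemma prox_finite:
  assumes "proper_lsc_convex r" and "is_prox \<eta> r v p"
  shows "\<bar>r p\<bar> \<noteq> \<infinity>"
proof -
  obtain x where x: "r x \<noteq> \<infinity>" and nm: "\<And>y. r y \<noteq> -\<infinity>"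
    using assms(1) by (auto simp: proper_lsc_convex_def)
  have "r p + ereal (1 / (2 * \<eta>) * (norm (p - v))\<^sup>2) \<le> r x + ereal (1 / (2 * \<eta>) * (norm (x - v))\<^sup>2)"
    using assms(2) by (auto simp: is_prox_def is_arg_min_def not_less)
  with x nm[of x] nm[of p] show ?thesis by (cases "r p"; cases "r x") auto
qed

text \<open>This is the optimality condition of the proximal map:
  \<open>(v - p) /\<^sub>R \<eta>\<close> is a subgradient of \<open>r\<close> at \<open>p\<close>.
  Minimality of \<open>p\<close> is tested against points of the segment from \<open>p\<close> to
  \<open>u\<close>, where convexity bounds \<open>r\<close>; after division by the segment parameter
  \<open>s\<close>, the quadratic remainder vanishes as \<open>s\<close> tends to 0 from the
  right.\<close>

lemma prox_subgradient:
  fixes r :: "'a::real_inner \<Rightarrow> ereal"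
  assumes conv: "proper_lsc_convex r" and prox: "is_prox \<eta> r v p" and "\<eta> > 0" and ru: "\<bar>r u\<bar> \<noteq> \<infinity>"
  shows "real_of_ereal (r p) + ((v - p) /\<^sub>R \<eta>) \<bullet> (u - p) \<le> real_of_ereal (r u)"
proof -
  obtain a where a: "r p = ereal a" using prox_finite[OF conv prox] by auto
  obtain b where b: "r u = ereal b" using ru by auto
  define c where "c = 1 / (2 * \<eta>)"
  define d where "d = u - p"
  have c: "c > 0" using \<open>\<eta> > 0\<close> by (simp add: c_def)
  have *: "a - b - 2 * c * ((p - v) \<bullet> d) \<le> s * (c * (d \<bullet> d))" if s: "s \<in> {0<..<1}" for s
  proof -
    let ?w = "(1 - s) *\<^sub>R p + s *\<^sub>R u"
    have "r ?w \<le> ereal (1 - s) * r p + ereal s * r u"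
      using conv s by (auto simp: proper_lsc_convex_def)
    then have "r ?w \<le> ereal ((1 - s) * a + s * b)" by (simp add: a b)
    then have "r ?w + ereal (c * (norm (?w - v))\<^sup>2) \<le> ereal ((1 - s) * a + s * b) + ereal (c * (norm (?w - v))\<^sup>2)"
      by (rule add_right_mono)
    moreover have "r p + ereal (c * (norm (p - v))\<^sup>2) \<le> r ?w + ereal (c * (norm (?w - v))\<^sup>2)"
      using prox by (auto simp: is_prox_def is_arg_min_def not_less c_def)
    ultimately have "r p + ereal (c * (norm (p - v))\<^sup>2) \<le> ereal ((1 - s) * a + s * b) + ereal (c * (norm (?w - v))\<^sup>2)"
      by (rule order_trans[rotated])
    then have "a + c * (norm (p - v))\<^sup>2 \<le> (1 - s) * a + s * b + c * (norm (?w - v))\<^sup>2"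
      by (simp add: a)
    moreover define I Q N where "I = (p - v) \<bullet> d" and "Q = d \<bullet> d" and "N = (norm (p - v))\<^sup>2"
    moreover have w: "?w - v = (p - v) + s *\<^sub>R d" by (simp add: d_def algebra_simps)
    have "(norm (?w - v))\<^sup>2 = N + 2 * s * I + s * s * Q"
      unfolding power2_norm_eq_inner w I_def Q_def N_def
      by (simp add: inner_add_left inner_add_right inner_commute[of d "p - v"] distrib_left mult.assoc)
    ultimately have "a + c * N \<le> (1 - s) * a + s * b + c * (N + 2 * s * I + s * s * Q)" by simp
    then have "s * (a - b - 2 * c * I) \<le> s * (s * (c * Q))"
      by (simp add: algebra_simps)
    with s show ?thesis by (auto simp: I_def Q_def intro: mult_left_le_imp_le)
  qed
  have "((\<lambda>s. s * (c * (d \<bullet> d))) \<longlongrightarrow> 0 * (c * (d \<bullet> d))) (at_right 0)"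
    by (intro tendsto_intros)
  moreover have "eventually (\<lambda>s. a - b - 2 * c * ((p - v) \<bullet> d) \<le> s * (c * (d \<bullet> d))) (at_right 0)"
    using eventually_at_right_real[of 0 1] by (auto elim!: eventually_mono intro: *)
  ultimately have "a - b - 2 * c * ((p - v) \<bullet> d) \<le> 0 * (c * (d \<bullet> d))"
    by (intro tendsto_lowerbound) auto
  moreover have "((v - p) /\<^sub>R \<eta>) \<bullet> d = - (2 * c * ((p - v) \<bullet> d))"
    using \<open>\<eta> > 0\<close> by (simp add: c_def inner_diff_left field_simps)
  ultimately show ?thesis by (simp add: a b d_def)
qed

section \<open>First moment of the Gaussian noise and its growth\<close>

lemma prod_Basis_cart:
  fixes f :: "real^'d::finite \<Rightarrow> 'b::comm_monoid_mult"
  shows "(\<Prod>b\<in>Basis. f b) = (\<Prod>i\<in>UNIV. f (axis i 1))"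
proof -
  have Basis: "(Basis :: (real^'d) set) = (\<lambda>i. axis i 1) ` UNIV"
    by (auto simp: Basis_vec_def)
  have "inj (\<lambda>i::'d. axis i (1::real))" by (auto simp: inj_def axis_eq_axis)
  then show ?thesis unfolding Basis by (subst prod.reindex) (simp_all add: o_def)
qed

text \<open>The norm is at most the sum of the absolute coordinates, and the product density turns
  the integral of each coordinate into a product of one-dimensional Gaussian moments of order 0 or
  1.\<close>

lemma isotropic_gaussian_first_moment:
  "(\<integral>\<^sup>+x. ennreal (norm x) \<partial>(isotropic_gaussian \<sigma> :: (real^'d::finite) measure)) < \<infinity>"
proof -
  define q :: "real^'d \<Rightarrow> ennreal" where "q x = ennreal (\<Prod>i\<in>UNIV. std_normal_density (x $ i))" for x
  have coord: "(\<integral>\<^sup>+x. q x * ennreal \<bar>x $ j\<bar> \<partial>lborel) < \<infinity>" for j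
  proof -
    \<comment> \<open>The weight \<open>\<bar>y\<bar>\<close> is placed in the single factor of
      coordinate \<open>j\<close>, so that the integrand is a product over \<open>Basis\<close> and
      Tonelli applies.\<close>
    define F :: "real^'d \<Rightarrow> real \<Rightarrow> real"
      where "F b y = std_normal_density y * (if b = axis j 1 then \<bar>y\<bar> else 1)" for b y
    have F: "F b y \<ge> 0" for b y by (simp add: F_def)
    have [measurable]: "F b \<in> borel_measurable borel" for b
      unfolding F_def by (cases "b = axis j 1") simp_all
    have "q x * ennreal \<bar>x $ j\<bar> = (\<Prod>b\<in>Basis. ennreal (F b (x \<bullet> b)))" for x
    proof -
      have "(\<Prod>i\<in>UNIV. if i = j then \<bar>x $ i\<bar> else 1) = \<bar>x $ j\<bar>" by (simp add: prod.delta)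
      then show ?thesis
        by (simp add: prod_Basis_cart inner_axis F_def axis_eq_axis q_def prod_ennreal ennreal_mult'[symmetric] prod.distrib prod_nonneg)
    qed
    then have "(\<integral>\<^sup>+x. q x * ennreal \<bar>x $ j\<bar> \<partial>lborel) = (\<Prod>b\<in>Basis. \<integral>\<^sup>+y. ennreal (F b y) \<partial>lborel)"
      using nn_integral_lborel_prod[of "\<lambda>b y. ennreal (F b y)"] by simp
    also have "\<dots> < \<infinity>"
    proof -
      have "integrable lborel (F b)" for b
        using integrable_std_normal_moment_abs[of 1] integrable_std_normal_moment_abs[of 0]
        unfolding F_def by (cases "b = axis j 1") simp_all
      then have "(\<integral>\<^sup>+y. ennreal (F b y) \<partial>lborel) < top" for b
        using F by (simp add: integrable_iff_bounded top.not_eq_extremum)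
      then show ?thesis by (simp add: ennreal_prod_eq_top less_top[symmetric] order_less_imp_not_eq)
    qed
    finally show ?thesis .
  qed
  have [measurable]: "q \<in> borel_measurable borel" unfolding q_def by measurable
  have "(\<integral>\<^sup>+x. ennreal (norm x) \<partial>(isotropic_gaussian \<sigma> :: (real^'d) measure)) = (\<integral>\<^sup>+x. q x * ennreal (norm (\<sigma> *\<^sub>R x)) \<partial>lborel)"
    by (simp add: isotropic_gaussian_def nn_integral_distr nn_integral_density flip: q_def)
  also have "\<dots> \<le> (\<integral>\<^sup>+x. (\<Sum>j\<in>UNIV. ennreal \<bar>\<sigma>\<bar> * (q x * ennreal \<bar>x $ j\<bar>)) \<partial>lborel)"
  proof (rule nn_integral_mono)
    fix x :: "real^'d"
    have "norm (\<sigma> *\<^sub>R x) \<le> \<bar>\<sigma>\<bar> * (\<Sum>j\<in>UNIV. \<bar>x $ j\<bar>)"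
      by (simp add: mult_left_mono norm_le_l1_cart)
    then have "q x * ennreal (norm (\<sigma> *\<^sub>R x)) \<le> q x * ennreal (\<bar>\<sigma>\<bar> * (\<Sum>j\<in>UNIV. \<bar>x $ j\<bar>))"
      by (intro mult_left_mono ennreal_leI) auto
    also have "\<dots> = (\<Sum>j\<in>UNIV. ennreal \<bar>\<sigma>\<bar> * (q x * ennreal \<bar>x $ j\<bar>))"
      by (simp add: ennreal_mult' sum_distrib_left mult.left_commute[of "ennreal \<bar>\<sigma>\<bar>" "q x"]
          flip: sum_ennreal del: sum_ennreal)
    finally show "q x * ennreal (norm (\<sigma> *\<^sub>R x)) \<le> (\<Sum>j\<in>UNIV. ennreal \<bar>\<sigma>\<bar> * (q x * ennreal \<bar>x $ j\<bar>))" .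
  qed
  also have "\<dots> = (\<Sum>j\<in>UNIV. ennreal \<bar>\<sigma>\<bar> * (\<integral>\<^sup>+x. q x * ennreal \<bar>x $ j\<bar> \<partial>lborel))"
    by (subst nn_integral_sum) (simp_all add: nn_integral_cmult)
  also have "\<dots> < \<infinity>"
    using coord by (simp add: ennreal_mult_less_top)
  finally show ?thesis .
qed

text \<open>The series of the weighted norms \<open>h ^ t * norm (Z t \<omega>)\<close> has
  expectation at most \<open>c / (1 - h)\<close>. Hence it is almost surely finite and its terms are
  bounded; the bound \<open>K\<close> depends on the path.\<close>

lemma AE_geometric_growth:
  fixes Z :: "nat \<Rightarrow> 'w \<Rightarrow> 'b::{real_normed_vector, second_countable_topology}"
  assumes [measurable]: "\<And>t. Z t \<in> borel_measurable W"
    and Z: "\<And>t. (\<integral>\<^sup>+\<omega>. ennreal (norm (Z t \<omega>)) \<partial>W) \<le> c" and "c < \<infinity>" and h: "0 < h" "h < 1"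
  shows "AE \<omega> in W. \<exists>K. \<forall>t. norm (Z t \<omega>) \<le> K / h ^ t"
proof -
  have "(\<integral>\<^sup>+\<omega>. (\<Sum>t. ennreal (h ^ t * norm (Z t \<omega>))) \<partial>W) = (\<Sum>t. \<integral>\<^sup>+\<omega>. ennreal (h ^ t * norm (Z t \<omega>)) \<partial>W)"
    by (rule nn_integral_suminf) simp
  also have "\<dots> = (\<Sum>t. ennreal (h ^ t) * (\<integral>\<^sup>+\<omega>. ennreal (norm (Z t \<omega>)) \<partial>W))"
    using h by (simp add: ennreal_mult' nn_integral_cmult)
  also have "\<dots> \<le> (\<Sum>t. ennreal (h ^ t) * c)"
    by (intro suminf_le mult_left_mono Z) auto
  also have "\<dots> = ennreal (\<Sum>t. h ^ t) * c"
    using h by (simp add: suminf_ennreal2 summable_geometric)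
  also have "\<dots> < \<infinity>" using \<open>c < \<infinity>\<close> by (simp add: ennreal_mult_less_top)
  finally have "AE \<omega> in W. (\<Sum>t. ennreal (h ^ t * norm (Z t \<omega>))) \<noteq> \<infinity>"
    by (intro nn_integral_PInf_AE) auto
  then show ?thesis
  proof eventually_elim
    case (elim \<omega>)
    have "summable (\<lambda>t. h ^ t * norm (Z t \<omega>))"
      using elim h by (intro summable_suminf_not_top) auto
    then have "(\<lambda>t. h ^ t * norm (Z t \<omega>)) \<longlonglongrightarrow> 0" by (rule summable_LIMSEQ_zero)
    then have "Bseq (\<lambda>t. h ^ t * norm (Z t \<omega>))" by (intro convergent_imp_Bseq convergentI)
    then obtain K where "\<And>t. norm (h ^ t * norm (Z t \<omega>)) \<le> K" by (auto simp: Bseq_def)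
    with h have "norm (Z t \<omega>) \<le> K / h ^ t" for t by (simp add: field_simps abs_mult)
    then show ?case by blast
  qed
qed

section \<open>Sequences with geometrically small terms or increments\<close>

lemma geometric_square_summable:
  fixes a :: "nat \<Rightarrow> 'a::real_normed_vector"
  assumes "\<And>n. norm (a n) \<le> B * h ^ n" and "0 < h" "h < 1"
  shows "summable (\<lambda>n. (norm (a n))\<^sup>2)"
proof (rule summable_comparison_test'[of "\<lambda>n. B\<^sup>2 * (h\<^sup>2) ^ n" 0])
  show "summable (\<lambda>n. B\<^sup>2 * (h\<^sup>2) ^ n)"
    using assms(2,3) by (intro summable_mult summable_geometric) (simp add: power_less_one_iff)
  have "(h ^ n)\<^sup>2 = (h\<^sup>2) ^ n" for n by (simp only: power_mult[symmetric] mult.commute)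
  then show "norm ((norm (a n))\<^sup>2) \<le> B\<^sup>2 * (h\<^sup>2) ^ n" for n
    using power_mono[OF assms(1)[of n], of 2] by (simp add: power_mult_distrib)
qed

lemma square_summable_tendsto_zero:
  fixes a :: "nat \<Rightarrow> 'a::real_normed_vector"
  assumes "summable (\<lambda>n. (norm (a n))\<^sup>2)"
  shows "(\<lambda>n. norm (a n)) \<longlonglongrightarrow> 0"
  using tendsto_real_sqrt[OF summable_LIMSEQ_zero[OF assms]] by simp

lemma geometric_steps_convergent:
  fixes a :: "nat \<Rightarrow> 'a::banach"
  assumes "\<And>n. norm (a (Suc n) - a n) \<le> B * h ^ n" and "0 < h" "h < 1"
  shows "convergent a"
proof -
  have "summable (\<lambda>n. a (Suc n) - a n)"
  proof (rule summable_comparison_test'[of "\<lambda>n. B * h ^ n" 0])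
    show "summable (\<lambda>n. B * h ^ n)" using assms(2,3) by (intro summable_mult summable_geometric) simp
  qed (use assms(1) in simp)
  then have "convergent (\<lambda>n. a n - a 0)"
    unfolding summable_iff_convergent sum_lessThan_telescope .
  then have "convergent (\<lambda>n. (a n - a 0) + a 0)" by (rule convergent_add[OF _ convergent_const])
  then show ?thesis by simp
qed

text \<open>
  Monotonicity of the subdifferential makes \<open>w n + p (Suc n)\<close> no longer than \<open>w n + p n\<close>, so the
  subgradients grow at most like the partial sums of the perturbations \<open>w\<close>.
\<close>
lemma proximal_path_bounds:
  fixes y p w :: "nat \<Rightarrow> 'a::real_inner" and f e :: "nat \<Rightarrow> real"
  assumes sub: "\<And>m n. f n + p n \<bullet> (y m - y n) \<le> f m"
    and upd: "\<And>n. y (Suc n) = y n - e n *\<^sub>R (w n + p (Suc n))"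
    and e: "\<And>n. e n > 0" and h: "0 < h" "h < 1" and w: "\<And>n. norm (w n) \<le> D / h ^ n"
  shows "\<exists>B\<ge>0. \<forall>n. norm (y (Suc n) - y n) \<le> B * e n / h ^ n \<and> \<bar>f (Suc n) - f n\<bar> \<le> B * e n / h ^ (2 * n)"
proof -
  define d where "d n = y (Suc n) - y n" for n
  have d: "d n = - e n *\<^sub>R (w n + p (Suc n))" for n by (simp add: d_def upd)
  have lo: "p n \<bullet> d n \<le> f (Suc n) - f n" for n using sub[of n "Suc n"] by (simp add: d_def)
  have hi: "f (Suc n) - f n \<le> p (Suc n) \<bullet> d n" for n
    using sub[of "Suc n" n] by (simp add: d_def inner_diff_right)
  \<comment> \<open>By \<open>lo\<close> and \<open>hi\<close> the subdifferential is monotone: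
    \<open>p n \<bullet> d n \<le> p (Suc n) \<bullet> d n\<close>. In the expansion of
    \<open>norm (d n)\<close> squared, the new subgradient can therefore be replaced by the old one,
    and Cauchy-Schwarz leaves one factor \<open>norm (d n)\<close> to cancel.\<close>
  have step: "norm (d n) \<le> e n * norm (w n + p n)" for n
  proof -
    have "norm (d n) * norm (d n) = - e n * ((w n + p (Suc n)) \<bullet> d n)"
      unfolding power2_eq_square[symmetric] power2_norm_eq_inner by (subst d) simp
    also have "\<dots> \<le> - e n * ((w n + p n) \<bullet> d n)"
      using order_trans[OF lo hi, of n] e[of n] by (simp add: inner_add_left)
    also have "\<dots> = e n * ((- (w n + p n)) \<bullet> d n)"
      by (simp only: inner_minus_left mult_minus_left mult_minus_right)
    also have "\<dots> \<le> e n * (norm (w n + p n) * norm (d n))"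
      using e[of n] norm_cauchy_schwarz[of "- (w n + p n)" "d n"] by (intro mult_left_mono) (auto simp only: norm_minus_cancel)
    finally have "norm (d n) * norm (d n) \<le> (e n * norm (w n + p n)) * norm (d n)" by simp
    then show ?thesis using e[of n] by (cases "d n = 0") auto
  qed
  have grow: "norm (p (Suc n)) \<le> norm (p n) + 2 * norm (w n)" for n
  proof -
    have "e n * norm (w n + p (Suc n)) \<le> e n * norm (w n + p n)"
      using step[of n] e[of n] by (simp add: d)
    then have "norm (w n + p (Suc n)) \<le> norm (w n + p n)" using e[of n] by simp
    moreover have "norm (p (Suc n)) \<le> norm (w n + p (Suc n)) + norm (w n)"
      using norm_triangle_ineq4[of "w n + p (Suc n)" "w n"] by simp
    ultimately show ?thesis using norm_triangle_ineq[of "w n" "p n"] by simp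
  qed
  have D: "D \<ge> 0" using order_trans[OF norm_ge_zero w[of 0]] by simp
  \<comment> \<open>\<open>norm (p 0)\<close> serves the base case. The second summand gives
    \<open>M * (1 - h) \<ge> 2 * D \<ge> 2 * D * h\<close>, which is what the bound
    \<open>M / h ^ n\<close> needs to survive an increase by \<open>2 * D / h ^ n\<close>.\<close>
  define M where "M = norm (p 0) + 2 * D / (1 - h)"
  have M: "M \<ge> 0" and Mh: "h * (M + 2 * D) \<le> M"
  proof -
    show "M \<ge> 0" using D h by (simp add: M_def)
    have "2 * D * h \<le> 2 * D" using D h by (simp add: mult_left_le)
    also have "2 * D = (2 * D / (1 - h)) * (1 - h)" using h by simp
    also have "\<dots> \<le> M * (1 - h)" unfolding M_def using h by (intro mult_right_mono) auto
    finally show "h * (M + 2 * D) \<le> M" by (simp add: algebra_simps)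
  qed
  have p: "norm (p n) \<le> M / h ^ n" for n
  proof (induction n)
    case 0
    then show ?case using D h by (simp add: M_def)
  next
    case (Suc n)
    have "norm (p (Suc n)) \<le> (M + 2 * D) / h ^ n"
      using grow[of n] Suc w[of n] by (simp add: add_divide_distrib)
    also have "\<dots> = (h * (M + 2 * D)) / h ^ Suc n" using h by simp
    also have "\<dots> \<le> M / h ^ Suc n"
      using Mh h by (intro divide_right_mono) auto
    finally show ?case .
  qed
  \<comment> \<open>One constant for both claims: it dominates \<open>D + M\<close> for the steps
    and \<open>(D + M) * (M + 2 * D)\<close> for the increments of \<open>f\<close>.\<close>
  define B where "B = (D + M) * (1 + M + 2 * D)"
  have B1: "D + M \<le> B" unfolding B_def using D M by (simp add: mult_le_cancel_left1)
  have *: "norm (d n) \<le> e n * ((D + M) / h ^ n)" for n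
  proof -
    have "norm (w n + p n) \<le> (D + M) / h ^ n"
      using norm_triangle_ineq[of "w n" "p n"] p[of n] w[of n] by (simp add: add_divide_distrib)
    then show ?thesis using step[of n] e[of n] by (meson mult_left_mono less_imp_le order_trans)
  qed
  have "norm (d n) \<le> B * e n / h ^ n" for n
  proof -
    have "e n * ((D + M) / h ^ n) \<le> e n * (B / h ^ n)"
      using B1 e[of n] h by (intro mult_left_mono divide_right_mono) auto
    then show ?thesis using *[of n] by (simp add: mult.commute)
  qed
  \<comment> \<open>The increment lies between the pairings of \<open>d n\<close> with the old and
    the new subgradient. The subgradient and the step each contribute a factor
    \<open>1 / h ^ n\<close>.\<close>
  moreover have "\<bar>f (Suc n) - f n\<bar> \<le> B * e n / h ^ (2 * n)" for n
  proof -
    have "norm (p (Suc n)) \<le> (M + 2 * D) / h ^ n" and "norm (p n) \<le> (M + 2 * D) / h ^ n"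
      using grow[of n] p[of n] w[of n] D h by (auto simp: add_divide_distrib intro: order_trans[OF p])
    then have q: "\<bar>p (Suc n) \<bullet> d n\<bar> \<le> (M + 2 * D) / h ^ n * norm (d n)" "\<bar>p n \<bullet> d n\<bar> \<le> (M + 2 * D) / h ^ n * norm (d n)"
      by (meson Cauchy_Schwarz_ineq2 mult_right_mono norm_ge_zero order_trans)+
    have pw: "h ^ (2 * n) = h ^ n * h ^ n" by (simp add: mult_2 power_add)
    have "\<bar>f (Suc n) - f n\<bar> \<le> (M + 2 * D) / h ^ n * norm (d n)"
      using lo[of n] hi[of n] q by linarith
    also have "(M + 2 * D) / h ^ n * norm (d n) \<le> (M + 2 * D) / h ^ n * (e n * ((D + M) / h ^ n))"
      using * D M h by (intro mult_left_mono) auto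
    also have "\<dots> = ((D + M) * (M + 2 * D)) * (e n / h ^ (2 * n))"
      unfolding pw by (simp only: times_divide_eq_right times_divide_eq_left divide_divide_eq_left ac_simps)
    also have "\<dots> \<le> B * (e n / h ^ (2 * n))"
      unfolding B_def using D M e[of n] h by (intro mult_right_mono mult_left_mono) auto
    finally show ?thesis by simp
  qed
  ultimately show ?thesis using B1 D M by (intro exI[of _ B]) (auto simp: d_def)
qed

section \<open>Deterministic bounds on the updates\<close>

lemma penalty_geometric: "penalty P t k = penalty0 P k / gam P k ^ t"
  by (induction t) simp_all

lemma penalty_pos:
  assumes "dpdt_problem_ok P" and "k \<in> {1..n_micro P}"
  shows "penalty P t k > 0"
  using assms by (auto simp: penalty_geometric dpdt_problem_ok_def)

text \<open>The rate is written as a fourth power so that two factors \<open>1 / h ^ t\<close> can later be absorbed.\<close>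
lemma penalty_growth:
  assumes "dpdt_problem_ok P"
  obtains h m where "0 < h" "h < 1" "0 < m" "\<And>t k. k \<in> {1..n_micro P} \<Longrightarrow> m / h ^ (4 * t) \<le> penalty P t k"
proof -
  define I where "I = {1..n_micro P}"
  have I: "finite I" "I \<noteq> {}" and pos: "\<And>k. k \<in> I \<Longrightarrow> penalty0 P k > 0 \<and> 0 < gam P k \<and> gam P k < 1"
    using assms by (auto simp: dpdt_problem_ok_def I_def)
  \<comment> \<open>The largest \<open>gam P k\<close> belongs to the slowest growing penalty and
    the smallest initial value bounds the others, so \<open>g\<close> and \<open>m\<close> work for
    all \<open>k\<close> at once.\<close>
  define g where "g = Max (gam P ` I)"
  define m where "m = Min (penalty0 P ` I)"
  define h where "h = sqrt (sqrt g)"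
  have g: "0 < g" "g < 1" using I pos by (auto simp: g_def Max_gr_iff)
  have m: "0 < m" using I pos by (auto simp: m_def)
  have h: "0 < h" "h < 1" using g by (auto simp: h_def)
  have "h ^ 4 = (h\<^sup>2)\<^sup>2" by simp
  also have "\<dots> = g" using g by (simp add: h_def)
  finally have h4: "h ^ (4 * t) = g ^ t" for t by (simp add: power_mult)
  have "m / h ^ (4 * t) \<le> penalty P t k" if "k \<in> {1..n_micro P}" for t k
  proof -
    have k: "k \<in> I" using that by (simp add: I_def)
    then have "gam P k \<le> g" "m \<le> penalty0 P k" using I by (auto simp: g_def m_def)
    with pos[OF k] m show ?thesis
      unfolding penalty_geometric h4 by (intro frac_le power_mono) auto
  qed
  with h m that show ?thesis by blast
qed

section \<open>Bounds on the global step size, the local updates and the surrogate gradient\<close>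

lemma eta_hat_pos:
  assumes "dpdt_problem_ok P"
  shows "eta_hat P t > 0"
proof -
  have "(\<Sum>k=1..n_micro P. penalty P t k) > 0"
    using assms by (intro sum_pos) (auto simp: dpdt_problem_ok_def intro: penalty_pos[OF assms])
  then show ?thesis using assms by (auto simp: eta_hat_def dpdt_problem_ok_def)
qed

lemma eta_hat_le:
  assumes "dpdt_problem_ok P" and k: "k \<in> {1..n_micro P}"
  shows "eta_hat P t \<le> real (n_micro P) * global_rate P / penalty P t k"
proof -
  have "penalty P t k \<le> (\<Sum>k=1..n_micro P. penalty P t k)"
    using k penalty_pos[OF assms(1)] by (intro member_le_sum) (auto intro: less_imp_le)
  moreover have "0 < penalty P t k" by (rule penalty_pos[OF assms])
  moreover have "0 \<le> real (n_micro P) * global_rate P"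
    using assms(1) by (auto simp: dpdt_problem_ok_def)
  ultimately show ?thesis unfolding eta_hat_def by (intro divide_left_mono) auto
qed

lemma norm_clipped_dual_le:
  assumes "clip P t > 0"
  shows "norm (clipped_dual P X t k \<omega>) \<le> clip P t"
proof -
  have "clip P t / max (clip P t) (norm (dual X t k \<omega>)) * norm (dual X t k \<omega>) \<le> clip P t"
    using assms by (auto simp: max_def field_simps)
  then show ?thesis using assms by (simp add: clipped_dual_def max_def)
qed

text \<open>
  The step rule keeps both the clipped dual variable and its translate by twice the dual update in the
  ball of radius \<open>clip P t\<close>: hence the local update has length at most \<open>clip P t / penalty P t k\<close>, and
  the new dual variable, their midpoint, stays in the ball.
\<close>
lemma local_update_bounds:
  assumes ok: "dpdt_problem_ok P" and alg: "dpdt_algorithm W P X"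
    and \<omega>: "\<omega> \<in> space W" and k: "k \<in> {1..n_micro P}"
  shows "norm (loc X (Suc t) k \<omega> - glob X t \<omega>) \<le> clip P 0 / penalty P t k"
    and "norm (dual X (Suc t) k \<omega>) \<le> clip P 0"
proof -
  define c u v where "c = clipped_dual P X t k \<omega>" and "u = loc X (Suc t) k \<omega> - glob X t \<omega>"
    and "v = c + (2 * penalty P t k) *\<^sub>R u"
  have pen: "penalty P t k > 0" by (rule penalty_pos[OF ok k])
  have clip: "clip P t > 0" "clip P t \<le> clip P 0"
    using ok by (auto simp: dpdt_problem_ok_def antimono_def)
  have u: "u = - step X t k \<omega> *\<^sub>R local_dir P X t k \<omega>"
    and adm: "step X t k \<omega> \<in> admissible_steps P X t k \<omega>"
    and dual: "dual X (Suc t) k \<omega> = c + penalty P t k *\<^sub>R u"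
    using alg \<omega> k by (auto simp: dpdt_algorithm_def u_def c_def)
  have v: "norm v \<le> clip P 0"
    using adm clip by (simp add: admissible_steps_def v_def u c_def)
  have c: "norm c \<le> clip P 0"
    using norm_clipped_dual_le[OF clip(1), of X k \<omega>] clip by (simp add: c_def)
  have "2 * (penalty P t k * norm u) = norm (v - c)" using pen by (simp add: v_def)
  also have "\<dots> \<le> 2 * clip P 0" using norm_triangle_ineq4[of v c] v c by simp
  finally show "norm (loc X (Suc t) k \<omega> - glob X t \<omega>) \<le> clip P 0 / penalty P t k"
    using pen by (simp add: u_def field_simps)
  have "2 *\<^sub>R dual X (Suc t) k \<omega> = c + v" by (simp add: dual v_def scaleR_2 algebra_simps)
  then have "2 * norm (dual X (Suc t) k \<omega>) = norm (c + v)" by (metis abs_numeral norm_scaleR)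
  then show "norm (dual X (Suc t) k \<omega>) \<le> clip P 0"
    using norm_triangle_ineq[of c v] v c by simp
qed

text \<open>In each summand of the gradient, the dual variable and the local update multiplied by
  its penalty are both at most \<open>clip P 0\<close> in norm; averaging keeps the bound. The
  growing penalty is offset by the shrinking update.\<close>

lemma norm_gradient_surrogate_le:
  assumes ok: "dpdt_problem_ok P" and alg: "dpdt_algorithm W P X" and \<omega>: "\<omega> \<in> space W"
  shows "norm (gradient (surrogate P X t \<omega>) (glob X t \<omega>)) \<le> 2 * clip P 0"
proof -
  have K: "real (n_micro P) > 0" using ok by (auto simp: dpdt_problem_ok_def)
  have "norm (dual X (Suc t) k \<omega> + penalty P t k *\<^sub>R (loc X (Suc t) k \<omega> - glob X t \<omega>)) \<le> 2 * clip P 0"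
    if k: "k \<in> {1..n_micro P}" for k
  proof -
    have "penalty P t k * norm (loc X (Suc t) k \<omega> - glob X t \<omega>) \<le> clip P 0"
      using local_update_bounds(1)[OF ok alg \<omega> k, of t] penalty_pos[OF ok k, of t] by (simp add: field_simps)
    then show ?thesis
      using local_update_bounds(2)[OF ok alg \<omega> k, of t] penalty_pos[OF ok k, of t]
      by (intro order_trans[OF norm_triangle_ineq]) simp
  qed
  then have "norm (\<Sum>k=1..n_micro P. dual X (Suc t) k \<omega> + penalty P t k *\<^sub>R (loc X (Suc t) k \<omega> - glob X t \<omega>))
      \<le> real (n_micro P) * (2 * clip P 0)"
    by (rule order_trans[OF sum_norm_bound]) auto
  with K show ?thesis by (simp add: gradient_surrogate field_simps)
qed

section \<open>Paths along which the noise grows slowly\<close>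

text \<open>Fixes one sample path, so that the rest is deterministic. \<open>h\<close> and
  \<open>m\<close> are the constants of \<open>penalty_growth\<close>, common to all paths, whereas
  \<open>N\<close> may depend on \<open>\<omega>\<close>. The same \<open>h\<close> measures the
  growth of the noise, which lets powers of it cancel against the penalties.\<close>

locale noise_bounded_path =
  fixes W :: "'w measure" and P :: "('d::finite, 'x) dpdt_problem" and X :: "('w, 'd) dpdt_run"
    and \<omega> :: 'w and h m N :: real
  assumes ok: "dpdt_problem_ok P" and alg: "dpdt_algorithm W P X" and \<omega>: "\<omega> \<in> space W"
    and h: "0 < h" "h < 1" and m: "0 < m"
    and penalty_ge: "\<And>t k. k \<in> {1..n_micro P} \<Longrightarrow> m / h ^ (4 * t) \<le> penalty P t k"
    and noise_le: "\<And>t. norm (noise X t \<omega>) \<le> N / h ^ t"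
begin

lemma clip0_pos: "clip P 0 > 0"
  using ok by (simp add: dpdt_problem_ok_def)

lemma divide_penalty_le:
  assumes "k \<in> {1..n_micro P}" and "0 \<le> a"
  shows "a / penalty P t k \<le> a / m * h ^ (4 * t)"
proof -
  have "a / penalty P t k \<le> a / (m / h ^ (4 * t))"
    using assms m h penalty_ge[OF assms(1), of t] by (intro frac_le) auto
  then show ?thesis by simp
qed

lemma power_h_le:
  assumes "n \<le> j"
  shows "h ^ j \<le> h ^ n"
  using h assms by (intro power_decreasing) auto

lemma local_update_le:
  assumes k: "k \<in> {1..n_micro P}"
  shows "norm (loc X (Suc t) k \<omega> - glob X t \<omega>) \<le> clip P 0 / m * h ^ t"
proof -
  have "norm (loc X (Suc t) k \<omega> - glob X t \<omega>) \<le> clip P 0 / m * h ^ (4 * t)"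
    using local_update_bounds(1)[OF ok alg \<omega> k] divide_penalty_le[OF k] clip0_pos
    by (meson less_imp_le order_trans)
  also have "\<dots> \<le> clip P 0 / m * h ^ t"
    using clip0_pos m by (intro mult_left_mono power_h_le) auto
  finally show ?thesis .
qed

text \<open>The index is shifted because \<open>reg P\<close> may be infinite at the initial model;
  from the first proximal step on it is finite.\<close>

definition reg_val :: "nat \<Rightarrow> real" where
  "reg_val n = real_of_ereal (reg P (glob X (Suc n) \<omega>))"

lemma prox_step:
  "is_prox (eta_hat P t) (reg P)
     (glob X t \<omega> - eta_hat P t *\<^sub>R (gradient (surrogate P X t \<omega>) (glob X t \<omega>) + noise X t \<omega>))
     (glob X (Suc t) \<omega>)"
  using alg \<omega> by (simp add: dpdt_algorithm_def)

lemma proper: "proper_lsc_convex (reg P)"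
  using ok by (simp add: dpdt_problem_ok_def)

lemma reg_eq: "reg P (glob X (Suc n) \<omega>) = ereal (reg_val n)"
  using prox_finite[OF proper prox_step[of n]] by (simp add: reg_val_def ereal_real)

text \<open>An instance of \<open>proximal_path_bounds\<close> for the path started at
  \<open>glob X 1\<close>, the first point at which a subgradient is supplied by the proximal
  map.\<close>

lemma global_update_bounds:
  "\<exists>B\<ge>0. \<forall>n. norm (glob X (Suc (Suc n)) \<omega> - glob X (Suc n) \<omega>) \<le> B * eta_hat P (Suc n) / h ^ n
     \<and> \<bar>reg_val (Suc n) - reg_val n\<bar> \<le> B * eta_hat P (Suc n) / h ^ (2 * n)"
proof -
  define w where "w t = gradient (surrogate P X t \<omega>) (glob X t \<omega>) + noise X t \<omega>" for t
  \<comment> \<open>The subgradient of \<open>reg P\<close> at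
    \<open>glob X (Suc t) \<omega>\<close> selected by the proximal map. With it, the implicit
    update becomes \<open>- eta_hat P t *\<^sub>R (w t + p t)\<close>.\<close>
  define p where "p t = (glob X t \<omega> - eta_hat P t *\<^sub>R w t - glob X (Suc t) \<omega>) /\<^sub>R eta_hat P t" for t
  have eta: "eta_hat P t > 0" for t by (rule eta_hat_pos[OF ok])
  show ?thesis
  proof (rule proximal_path_bounds[where p = p and w = "\<lambda>n. w (Suc n)" and D = "2 * clip P 0 + N / h"])
    show "reg_val n + p n \<bullet> (glob X (Suc j) \<omega> - glob X (Suc n) \<omega>) \<le> reg_val j" for j n
      using prox_subgradient[OF proper prox_step[of n] eta, of "glob X (Suc j) \<omega>"]
      by (simp add: reg_eq p_def w_def)
    show "glob X (Suc (Suc n)) \<omega> = glob X (Suc n) \<omega> - eta_hat P (Suc n) *\<^sub>R (w (Suc n) + p (Suc n))" for n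
      using eta[of "Suc n"] by (simp add: p_def scaleR_add_right)
    show "norm (w (Suc n)) \<le> (2 * clip P 0 + N / h) / h ^ n" for n
    proof -
      have "2 * clip P 0 \<le> 2 * clip P 0 / h ^ n"
        using clip0_pos h by (simp add: field_simps mult_left_le power_le_one)
      then show ?thesis
        using norm_gradient_surrogate_le[OF ok alg \<omega>, of "Suc n"] noise_le[of "Suc n"]
        unfolding w_def by (intro order_trans[OF norm_triangle_ineq]) (simp add: add_divide_distrib)
    qed
  qed (use eta h in auto)
qed

definition "gain = real (n_micro P) * global_rate P"

lemma gain_pos: "gain > 0"
  using ok by (auto simp: gain_def dpdt_problem_ok_def)

lemma eta_hat_geometric: "eta_hat P (Suc n) \<le> gain / m * h ^ (3 * n)"
proof -
  \<comment> \<open>Any single penalty bounds the sum in \<open>eta_hat\<close> from below; index 1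
    always exists.\<close>
  have 1: "1 \<in> {1..n_micro P}" using ok by (auto simp: dpdt_problem_ok_def)
  have "eta_hat P (Suc n) \<le> gain / m * h ^ (4 * Suc n)"
    using eta_hat_le[OF ok 1] divide_penalty_le[OF 1] gain_pos
    unfolding gain_def[symmetric] by (meson less_imp_le order_trans)
  also have "\<dots> \<le> gain / m * h ^ (3 * n)"
    using gain_pos m by (intro mult_left_mono power_h_le) auto
  finally show ?thesis .
qed

text \<open>\<open>eta_hat\<close> decays like \<open>h ^ (3 * n)\<close>, which absorbs the factor
  \<open>1 / h ^ n\<close> of the updates or \<open>1 / h ^ (2 * n)\<close> of the regularizer and
  still leaves \<open>h ^ n\<close>.\<close>

lemma global_update_geometric:
  "\<exists>B. \<forall>n. norm (glob X (Suc (Suc n)) \<omega> - glob X (Suc n) \<omega>) \<le> B * h ^ n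
     \<and> \<bar>reg_val (Suc n) - reg_val n\<bar> \<le> B * h ^ n"
proof -
  obtain B where B: "B \<ge> 0"
    "\<And>n. norm (glob X (Suc (Suc n)) \<omega> - glob X (Suc n) \<omega>) \<le> B * eta_hat P (Suc n) / h ^ n"
    "\<And>n. \<bar>reg_val (Suc n) - reg_val n\<bar> \<le> B * eta_hat P (Suc n) / h ^ (2 * n)"
    using global_update_bounds by blast
  have *: "B * eta_hat P (Suc n) / h ^ j \<le> (B * (gain / m)) * h ^ n" if "j + n \<le> 3 * n" for j n
  proof -
    have "B * eta_hat P (Suc n) \<le> B * (gain / m * h ^ (3 * n))"
      using B(1) eta_hat_geometric by (rule mult_left_mono[rotated])
    also have "\<dots> \<le> B * (gain / m * h ^ (j + n))"
      using B(1) gain_pos m that by (intro mult_left_mono power_h_le) auto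
    finally show ?thesis using h by (simp add: power_add field_simps)
  qed
  show ?thesis
    using order_trans[OF B(2) *] order_trans[OF B(3) *] by (intro exI[of _ "B * (gain / m)"]) auto
qed

text \<open>Both models are measured from \<open>glob X (Suc n) \<omega>\<close>, the common
  starting point of the iteration that produces them. Their distance is of order
  \<open>1 / (\<rho> n * h ^ n)\<close>, so that even its square times the unbounded penalty
  vanishes: this controls the quadratic term of the Lagrangian.\<close>

lemma consensus_gap:
  assumes k: "k \<in> {1..n_micro P}"
  shows "\<exists>D. \<forall>n. norm (loc X (Suc (Suc n)) k \<omega> - glob X (Suc (Suc n)) \<omega>) \<le> D * h ^ n
     \<and> penalty P (Suc (Suc n)) k * (norm (loc X (Suc (Suc n)) k \<omega> - glob X (Suc (Suc n)) \<omega>))\<^sup>2 \<le> D * h ^ n"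
proof -
  define d where "d n = norm (loc X (Suc (Suc n)) k \<omega> - glob X (Suc (Suc n)) \<omega>)" for n
  define \<rho> where "\<rho> n = penalty P (Suc n) k" for n
  have \<rho>: "\<rho> n > 0" for n unfolding \<rho>_def by (rule penalty_pos[OF ok k])
  have gam: "0 < gam P k" using ok k by (auto simp: dpdt_problem_ok_def)
  obtain B where B: "B \<ge> 0"
    "\<And>n. norm (glob X (Suc (Suc n)) \<omega> - glob X (Suc n) \<omega>) \<le> B * eta_hat P (Suc n) / h ^ n"
    using global_update_bounds by blast
  have d0: "0 \<le> d n" for n by (simp add: d_def)
  have pen2: "penalty P (Suc (Suc n)) k = \<rho> n / gam P k" for n by (simp add: \<rho>_def)
  \<comment> \<open>The local update contributes \<open>clip P 0\<close> and the global update
    \<open>B * gain\<close>.\<close>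
  define E where "E = clip P 0 + B * gain"
  have E: "E > 0" using clip0_pos B(1) gain_pos by (simp add: E_def add_pos_nonneg)
  have d: "d n \<le> E / (\<rho> n * h ^ n)" for n
  proof -
    have "norm (glob X (Suc (Suc n)) \<omega> - glob X (Suc n) \<omega>) \<le> B * (gain / \<rho> n) / h ^ n"
      using B(1) h eta_hat_le[OF ok k, of "Suc n"]
      by (intro order_trans[OF B(2)] divide_right_mono mult_left_mono) (auto simp: gain_def \<rho>_def)
    moreover have "norm (loc X (Suc (Suc n)) k \<omega> - glob X (Suc n) \<omega>) \<le> clip P 0 / \<rho> n / h ^ n"
    proof -
      have "clip P 0 / \<rho> n \<le> clip P 0 / \<rho> n / h ^ n"
        using clip0_pos h \<rho>[of n] by (simp add: field_simps mult_left_le power_le_one)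
      then show ?thesis
        using local_update_bounds(1)[OF ok alg \<omega> k, of "Suc n"] by (simp add: \<rho>_def)
    qed
    moreover have "d n \<le> norm (loc X (Suc (Suc n)) k \<omega> - glob X (Suc n) \<omega>)
        + norm (glob X (Suc (Suc n)) \<omega> - glob X (Suc n) \<omega>)"
      unfolding d_def using norm_triangle_ineq4[of "loc X (Suc (Suc n)) k \<omega> - glob X (Suc n) \<omega>"
        "glob X (Suc (Suc n)) \<omega> - glob X (Suc n) \<omega>"] by simp
    moreover have "E / (\<rho> n * h ^ n) = clip P 0 / \<rho> n / h ^ n + B * (gain / \<rho> n) / h ^ n"
      by (simp add: E_def add_divide_distrib)
    ultimately show ?thesis by linarith
  qed
  have inv: "a / (\<rho> n * h ^ j) \<le> a / m * h ^ n" if "a \<ge> 0" "j + n \<le> 4 * Suc n" for a j n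
  proof -
    have "a / \<rho> n \<le> a / m * h ^ (4 * Suc n)"
      unfolding \<rho>_def using k that(1) by (rule divide_penalty_le)
    also have "\<dots> \<le> a / m * h ^ (j + n)"
      using that m by (intro mult_left_mono power_h_le) auto
    finally have "a / \<rho> n / h ^ j \<le> a / m * h ^ (j + n) / h ^ j"
      using h by (intro divide_right_mono) auto
    then show ?thesis using h by (simp add: power_add)
  qed
  have "d n \<le> E / m * h ^ n" for n
    using d[of n] inv[of E n n] E by simp
  \<comment> \<open>The square carries two factors \<open>1 / \<rho> n\<close>. One cancels the
    penalty up to \<open>1 / gam P k\<close>, as the penalty has already been advanced; the other
    outweighs \<open>1 / h ^ (2 * n)\<close>.\<close>
  moreover have "penalty P (Suc (Suc n)) k * (d n)\<^sup>2 \<le> E\<^sup>2 / gam P k / m * h ^ n" for n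
  proof -
    have "penalty P (Suc (Suc n)) k * (d n)\<^sup>2 \<le> \<rho> n / gam P k * (E / (\<rho> n * h ^ n))\<^sup>2"
      unfolding pen2 using \<rho>[of n] gam d[of n] d0[of n] by (intro mult_left_mono power_mono) auto
    also have "\<dots> = E\<^sup>2 / gam P k / (\<rho> n * h ^ (2 * n))"
      using \<rho>[of n] h by (simp add: power2_eq_square power_add mult_2 divide_simps)
    also have "\<dots> \<le> E\<^sup>2 / gam P k / m * h ^ n"
      using gam by (intro inv) auto
    finally show ?thesis .
  qed
  moreover define D where "D = max (E / m) (E\<^sup>2 / gam P k / m)"
  have "E / m * h ^ n \<le> D * h ^ n" "E\<^sup>2 / gam P k / m * h ^ n \<le> D * h ^ n" for n
    unfolding D_def using h by (intro mult_right_mono; simp)+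
  ultimately show ?thesis unfolding d_def[symmetric] by (meson order_trans)
qed

section \<open>Convergence of the augmented Lagrangian and of the Lyapunov tail\<close>

lemma tendsto_zero_geometric:
  fixes a :: "nat \<Rightarrow> 'b::real_normed_vector"
  assumes "\<And>n. norm (a n) \<le> B * h ^ n"
  shows "a \<longlonglongrightarrow> 0"
proof (rule Lim_null_comparison)
  show "(\<lambda>n. B * h ^ n) \<longlonglongrightarrow> 0"
    using tendsto_mult[OF tendsto_const LIMSEQ_power_zero[of h]] h by simp
qed (use assms in simp)

lemma glob_convergent: "\<exists>\<theta>. (\<lambda>t. glob X t \<omega>) \<longlonglongrightarrow> \<theta>"
proof -
  obtain B where "\<And>n. norm (glob X (Suc (Suc n)) \<omega> - glob X (Suc n) \<omega>) \<le> B * h ^ n"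
    using global_update_geometric by blast
  then have "convergent (\<lambda>n. glob X (Suc n) \<omega>)"
    by (rule geometric_steps_convergent) (use h in auto)
  then obtain l where "(\<lambda>n. glob X (Suc n) \<omega>) \<longlonglongrightarrow> l" by (auto simp: convergent_def)
  then show ?thesis using LIMSEQ_imp_Suc[of "\<lambda>t. glob X t \<omega>"] by blast
qed

lemma reg_val_convergent: "convergent reg_val"
proof -
  obtain B where "\<And>n. norm (reg_val (Suc n) - reg_val n) \<le> B * h ^ n"
    using global_update_geometric by auto
  then show ?thesis by (rule geometric_steps_convergent) (use h in auto)
qed

lemma continuous_risk:
  assumes "j \<in> {1..n_mini P}" "k \<in> {1..n_micro P}"
  shows "isCont (risk P (micro P j k)) \<theta>"
  using ok assms differentiable_imp_continuous_within[of "risk P (micro P j k)" \<theta> UNIV]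
  by (auto simp: dpdt_problem_ok_def)

text \<open>Local and global models share a limit, so the risks converge by continuity. The
  regularizer values converge because their increments are geometrically small, which lower
  semicontinuity alone would not give. The linear terms vanish since the dual variables are bounded,
  the quadratic ones by \<open>consensus_gap\<close>.\<close>

lemma aug_lagrangian_convergent:
  "\<exists>l. (\<lambda>t. aug_lagrangian P (glob X t \<omega>) (\<lambda>k. loc X t k \<omega>) (\<lambda>k. dual X t k \<omega>) (penalty P t)) \<longlonglongrightarrow> ereal l"
proof -
  define \<Lambda> where "\<Lambda> t = aug_lagrangian P (glob X t \<omega>) (\<lambda>k. loc X t k \<omega>) (\<lambda>k. dual X t k \<omega>) (penalty P t)" for t
  define \<theta>g \<theta>l where "\<theta>g n = glob X (Suc (Suc n)) \<omega>" and "\<theta>l n k = loc X (Suc (Suc n)) k \<omega>" for n k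
  obtain \<theta> where "(\<lambda>t. glob X t \<omega>) \<longlonglongrightarrow> \<theta>" using glob_convergent by blast
  then have \<theta>g: "\<theta>g \<longlonglongrightarrow> \<theta>" unfolding \<theta>g_def by (intro LIMSEQ_Suc)
  obtain a where "reg_val \<longlonglongrightarrow> a" using reg_val_convergent by (auto simp: convergent_def)
  then have a: "(\<lambda>n. reg_val (Suc n)) \<longlonglongrightarrow> a" by (rule LIMSEQ_Suc)
  have gap: "(\<lambda>n. \<theta>l n k - \<theta>g n) \<longlonglongrightarrow> 0"
    and pen: "(\<lambda>n. penalty P (Suc (Suc n)) k / 2 * (norm (\<theta>l n k - \<theta>g n))\<^sup>2) \<longlonglongrightarrow> 0"
    if k: "k \<in> {1..n_micro P}" for k
  proof -
    obtain D where D: "\<And>n. norm (\<theta>l n k - \<theta>g n) \<le> D * h ^ n"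
      "\<And>n. penalty P (Suc (Suc n)) k * (norm (\<theta>l n k - \<theta>g n))\<^sup>2 \<le> D * h ^ n"
      using consensus_gap[OF k] unfolding \<theta>g_def \<theta>l_def by blast
    show "(\<lambda>n. \<theta>l n k - \<theta>g n) \<longlonglongrightarrow> 0" by (rule tendsto_zero_geometric[OF D(1)])
    have "0 < penalty P (Suc (Suc n)) k" for n by (rule penalty_pos[OF ok k])
    then have "norm (penalty P (Suc (Suc n)) k / 2 * (norm (\<theta>l n k - \<theta>g n))\<^sup>2) \<le> D / 2 * h ^ n" for n
      using D(2)[of n] by (simp add: abs_mult less_imp_le del: penalty.simps)
    then show "(\<lambda>n. penalty P (Suc (Suc n)) k / 2 * (norm (\<theta>l n k - \<theta>g n))\<^sup>2) \<longlonglongrightarrow> 0"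
      by (rule tendsto_zero_geometric)
  qed
  have \<theta>l: "(\<lambda>n. \<theta>l n k) \<longlonglongrightarrow> \<theta>" if "k \<in> {1..n_micro P}" for k
    using tendsto_add[OF gap[OF that] \<theta>g] by simp
  have lin: "(\<lambda>n. dual X (Suc (Suc n)) k \<omega> \<bullet> (\<theta>l n k - \<theta>g n)) \<longlonglongrightarrow> 0" if k: "k \<in> {1..n_micro P}" for k
  proof (rule Lim_null_comparison)
    show "(\<lambda>n. clip P 0 * norm (\<theta>l n k - \<theta>g n)) \<longlonglongrightarrow> 0"
      using tendsto_mult[OF tendsto_const tendsto_norm[OF gap[OF k]], of "clip P 0"] by simp
    show "\<forall>\<^sub>F n in sequentially. norm (dual X (Suc (Suc n)) k \<omega> \<bullet> (\<theta>l n k - \<theta>g n)) \<le> clip P 0 * norm (\<theta>l n k - \<theta>g n)"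
      using local_update_bounds(2)[OF ok alg \<omega> k]
      by (intro always_eventually allI) (simp, meson Cauchy_Schwarz_ineq2 mult_right_mono norm_ge_zero order_trans)
  qed
  let ?F = "\<lambda>n. (\<Sum>j=1..n_mini P. \<Sum>k=1..n_micro P. risk P (micro P j k) (\<theta>l n k)) / (real (n_mini P) * real (n_micro P))"
  let ?S = "\<lambda>n. (\<Sum>k=1..n_micro P. dual X (Suc (Suc n)) k \<omega> \<bullet> (\<theta>l n k - \<theta>g n)
      + penalty P (Suc (Suc n)) k / 2 * (norm (\<theta>l n k - \<theta>g n))\<^sup>2) / real (n_micro P)"
  define b where "b = (\<Sum>j=1..n_mini P. \<Sum>k=1..n_micro P. risk P (micro P j k) \<theta>) / (real (n_mini P) * real (n_micro P))"
  have F: "?F \<longlonglongrightarrow> b"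
    unfolding b_def divide_inverse
    by (intro tendsto_mult_right tendsto_sum isCont_tendsto_compose[OF continuous_risk] \<theta>l)
  have "?S \<longlonglongrightarrow> (\<Sum>k=1..n_micro P. 0 + 0) / real (n_micro P)"
    unfolding divide_inverse by (intro tendsto_mult_right tendsto_sum tendsto_add lin pen[unfolded divide_inverse])
  then have S: "?S \<longlonglongrightarrow> 0" by simp
  have "(\<lambda>n. ereal (?F n + reg_val (Suc n) + ?S n)) \<longlonglongrightarrow> ereal (b + a + 0)"
    by (intro tendsto_ereal tendsto_add F a S)
  moreover have "\<Lambda> (Suc (Suc n)) = ereal (?F n + reg_val (Suc n) + ?S n)" for n
    unfolding \<Lambda>_def aug_lagrangian_def reg_eq \<theta>g_def \<theta>l_def by simp
  ultimately have "(\<lambda>n. \<Lambda> (Suc (Suc n))) \<longlonglongrightarrow> ereal (b + a + 0)" by simp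
  then have "(\<lambda>n. \<Lambda> (Suc n)) \<longlonglongrightarrow> ereal (b + a + 0)" by (rule LIMSEQ_imp_Suc)
  then have "\<Lambda> \<longlonglongrightarrow> ereal (b + a + 0)" by (rule LIMSEQ_imp_Suc)
  then show ?thesis unfolding \<Lambda>_def by blast
qed

text \<open>
  Positivity of \<open>A_coef\<close> means \<open>c_coef > 2 * penalty + 1\<close>, so the series in the Lyapunov function
  converges geometrically.
\<close>
lemma lyapunov_tail:
  assumes A: "\<And>t k. k \<in> {1..n_micro P} \<Longrightarrow> A_coef P X L t k \<omega> > 0"
  shows "(\<lambda>t. \<Sum>i. \<zeta>\<^sup>2 / (2 * c_aux P X L ((t - 1) + i) \<omega>)) \<longlonglongrightarrow> 0"
proof -
  let ?a = "\<lambda>i. \<zeta>\<^sup>2 / (2 * c_aux P X L i \<omega>)"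
  have K: "{1..n_micro P} \<noteq> {}" "real (n_micro P) > 0" using ok by (auto simp: dpdt_problem_ok_def)
  have c: "m / h ^ (4 * t) \<le> c_aux P X L t \<omega>" for t
  proof -
    have "m / h ^ (4 * t) \<le> c_coef P X L t k \<omega>" if k: "k \<in> {1..n_micro P}" for k
    proof -
      have "0 < c_coef P X L t k \<omega> / 2 - penalty P t k - 1 / 2"
        using A[OF k, of t] K(2) unfolding A_coef_def by (elim zero_less_mult_pos) simp
      then show ?thesis using penalty_ge[OF k, of t] penalty_pos[OF ok k, of t] by simp
    qed
    then show ?thesis using K(1) by (simp add: c_aux_def)
  qed
  have "summable ?a"
  proof (rule summable_comparison_test'[of "\<lambda>i. \<zeta>\<^sup>2 / (2 * m) * h ^ i" 0])
    show "summable (\<lambda>i. \<zeta>\<^sup>2 / (2 * m) * h ^ i)"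
      using h by (intro summable_mult summable_geometric) simp
    show "norm (?a t) \<le> \<zeta>\<^sup>2 / (2 * m) * h ^ t" for t
    proof -
      have pos: "0 < m / h ^ (4 * t)" using m h by simp
      have "norm (?a t) = ?a t" using order.strict_trans2[OF pos c[of t]] by simp
      also have "\<dots> \<le> \<zeta>\<^sup>2 / (2 * (m / h ^ (4 * t)))"
        using c[of t] pos by (intro frac_le) auto
      also have "\<dots> = \<zeta>\<^sup>2 / (2 * m) * h ^ (4 * t)" by simp
      also have "\<dots> \<le> \<zeta>\<^sup>2 / (2 * m) * h ^ t" using m by (intro mult_left_mono power_h_le) auto
      finally show ?thesis .
    qed
  qed
  then have "(\<lambda>n. \<Sum>i. ?a (i + n)) \<longlonglongrightarrow> 0" by (rule suminf_exist_split2)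
  \<comment> \<open>Shifting by one index avoids the truncated subtraction at \<open>t = 0\<close>,
    which cannot affect the limit.\<close>
  then have "(\<lambda>t. \<Sum>i. ?a ((Suc t - 1) + i)) \<longlonglongrightarrow> 0" by (simp add: add.commute)
  then show ?thesis by (rule LIMSEQ_imp_Suc)
qed

end

section \<open>Almost sure convergence\<close>

text \<open>Needed to make the limit a random variable. The regularizer is Borel by lower
  semicontinuity, the risks because differentiability makes them continuous.\<close>

lemma borel_measurable_aug_lagrangian:
  assumes ok: "dpdt_problem_ok P" and alg: "dpdt_algorithm W P X"
  shows "(\<lambda>\<omega>. aug_lagrangian P (glob X t \<omega>) (\<lambda>k. loc X t k \<omega>) (\<lambda>k. dual X t k \<omega>) (penalty P t)) \<in> borel_measurable W"
proof -
  have [measurable]: "reg P \<in> borel_measurable borel"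
    using ok by (intro lsc_borel_measurable) (simp add: dpdt_problem_ok_def proper_lsc_convex_def)
  have risk: "risk P (micro P j k) \<in> borel_measurable borel" if "j \<in> {1..n_mini P}" "k \<in> {1..n_micro P}" for j k
  proof (rule borel_measurable_continuous_onI)
    show "continuous_on UNIV (risk P (micro P j k))"
      using ok that by (auto simp: dpdt_problem_ok_def continuous_on_eq_continuous_within intro!: differentiable_imp_continuous_within)
  qed
  have [measurable]: "glob X t \<in> borel_measurable W" using alg by (simp add: dpdt_algorithm_def)
  have l: "loc X t k \<in> borel_measurable W" "dual X t k \<in> borel_measurable W" if "k \<in> {1..n_micro P}" for k
    using alg that by (auto simp: dpdt_algorithm_def)
  show ?thesis
    unfolding aug_lagrangian_def
    by (intro borel_measurable_ereal_add borel_measurable_ereal borel_measurable_divide borel_measurable_sum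
        borel_measurable_add borel_measurable_times borel_measurable_inner borel_measurable_power measurable_compose[OF _ borel_measurable_norm]
        borel_measurable_diff measurable_compose[OF l(1) risk] l) auto
qed

theorem theorem7:
  fixes W :: "'w measure"
    and P :: "('d::finite, 'x) dpdt_problem"
    and X :: "('w, 'd) dpdt_run"
    and L \<zeta> \<Phi>min :: real
  assumes "prob_space W"
    and "dpdt_problem_ok P"
    and "dpdt_algorithm W P X"
    and smooth: "L-lipschitz_on UNIV (gradient (risk P (train P)))"
    and dissimilarity: "AE \<omega> in W. \<forall>t. \<forall>k\<in>{1..n_micro P}.
        norm (gradient (risk P (micro P (batch X t \<omega>) k)) (glob X t \<omega>)
              - gradient (risk P (train P)) (glob X t \<omega>)) \<le> \<zeta>"
    and bounded_below: "AE \<omega> in W. \<forall>t. ereal \<Phi>min \<le> lyapunov P X L \<zeta> t \<omega>"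
    and A_pos: "AE \<omega> in W. \<forall>t. \<forall>k\<in>{1..n_micro P}. A_coef P X L t k \<omega> > 0"
    and B_pos: "\<forall>t. B_coef P t > 0"
    and descent: "\<forall>t. AE \<omega> in W. expected_descent W P X L \<zeta> t \<omega>"
  shows "(\<exists>\<Phi>lim\<in>borel_measurable W.
            AE \<omega> in W. (\<lambda>t. lyapunov P X L \<zeta> t \<omega>) \<longlonglongrightarrow> ereal (\<Phi>lim \<omega>))
       \<and> (AE \<omega> in W. summable (\<lambda>t. (norm (glob X (Suc t) \<omega> - glob X t \<omega>))\<^sup>2))
       \<and> (\<forall>k\<in>{1..n_micro P}. AE \<omega> in W.
            summable (\<lambda>t. (norm (loc X (Suc t) k \<omega> - glob X t \<omega>))\<^sup>2))
       \<and> (AE \<omega> in W. (\<lambda>t. norm (glob X (Suc t) \<omega> - glob X t \<omega>)) \<longlonglongrightarrow> 0)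
       \<and> (\<forall>k\<in>{1..n_micro P}. AE \<omega> in W.
            (\<lambda>t. norm (loc X (Suc t) k \<omega> - glob X t \<omega>)) \<longlonglongrightarrow> 0)"
proof -
  interpret prob_space W by fact
  note ok = assms(2) and alg = assms(3)
  obtain h m where h: "0 < h" "h < 1" and m: "0 < m"
    and pen: "\<And>t k. k \<in> {1..n_micro P} \<Longrightarrow> m / h ^ (4 * t) \<le> penalty P t k"
    using penalty_growth[OF ok] by metis
  have noise [measurable]: "noise X t \<in> borel_measurable W"
    and law: "distr W borel (noise X t) = isotropic_gaussian (noise_sd P)" for t
    using alg by (auto simp: dpdt_algorithm_def)
  \<comment> \<open>All noise variables have the same law, so its first moment is a bound uniform in
    \<open>t\<close>; the rate \<open>h\<close> is the one of the penalties.\<close>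
  have "AE \<omega> in W. \<exists>N. \<forall>t. norm (noise X t \<omega>) \<le> N / h ^ t"
  proof (rule AE_geometric_growth[OF noise _ isotropic_gaussian_first_moment h])
    show "(\<integral>\<^sup>+\<omega>. ennreal (norm (noise X t \<omega>)) \<partial>W)
        \<le> (\<integral>\<^sup>+x. ennreal (norm x) \<partial>(isotropic_gaussian (noise_sd P) :: (real^'d) measure))" for t
      unfolding law[of t, symmetric] by (subst nn_integral_distr) auto
  qed
  then have path: "AE \<omega> in W. \<exists>N. noise_bounded_path W P X \<omega> h m N"
    using AE_space
  proof eventually_elim
    case (elim \<omega>)
    then show ?case using ok alg h m pen unfolding noise_bounded_path_def by blast
  qed

  define \<Lambda> where "\<Lambda> t \<omega> = aug_lagrangian P (glob X t \<omega>) (\<lambda>k. loc X t k \<omega>) (\<lambda>k. dual X t k \<omega>) (penalty P t)" for t \<omega>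
  \<comment> \<open>A lower limit is measurable by construction. Almost surely it is the limit of
    the Lagrangians, and also of the Lyapunov values because their tail tends to 0.\<close>
  define \<Phi>lim where "\<Phi>lim \<omega> = real_of_ereal (liminf (\<lambda>t. \<Lambda> t \<omega>))" for \<omega>
  have [measurable]: "\<Lambda> t \<in> borel_measurable W" for t
    unfolding \<Lambda>_def by (rule borel_measurable_aug_lagrangian[OF ok alg])
  have "\<Phi>lim \<in> borel_measurable W" unfolding \<Phi>lim_def by measurable
  moreover have "AE \<omega> in W. (\<lambda>t. lyapunov P X L \<zeta> t \<omega>) \<longlonglongrightarrow> ereal (\<Phi>lim \<omega>)"
    using path A_pos
  proof eventually_elim
    case (elim \<omega>)
    then obtain N where "noise_bounded_path W P X \<omega> h m N" by blast
    then interpret noise_bounded_path W P X \<omega> h m N .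
    obtain l where l: "(\<lambda>t. \<Lambda> t \<omega>) \<longlonglongrightarrow> ereal l"
      using aug_lagrangian_convergent unfolding \<Lambda>_def by blast
    have "liminf (\<lambda>t. \<Lambda> t \<omega>) = ereal l"
      using l by (intro lim_imp_Liminf) auto
    moreover have "(\<lambda>t. lyapunov P X L \<zeta> t \<omega>) \<longlonglongrightarrow> ereal l + ereal 0"
      unfolding lyapunov_def \<Lambda>_def[symmetric]
      using elim(2) by (intro tendsto_add_ereal_general1 l tendsto_ereal lyapunov_tail) auto
    ultimately show ?case by (simp add: \<Phi>lim_def)
  qed
  moreover have glob: "AE \<omega> in W. summable (\<lambda>t. (norm (glob X (Suc t) \<omega> - glob X t \<omega>))\<^sup>2)"
    using path
  proof eventually_elim
    case (elim \<omega>)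
    then obtain N where "noise_bounded_path W P X \<omega> h m N" by blast
    then interpret noise_bounded_path W P X \<omega> h m N .
    obtain B where "\<And>n. norm (glob X (Suc (Suc n)) \<omega> - glob X (Suc n) \<omega>) \<le> B * h ^ n"
      using global_update_geometric by blast
    then have "summable (\<lambda>n. (norm (glob X (Suc (Suc n)) \<omega> - glob X (Suc n) \<omega>))\<^sup>2)"
      using h by (rule geometric_square_summable)
    \<comment> \<open>The geometric bound starts at the second global update; the first one is a
      single extra term.\<close>
    then show ?case
      using summable_Suc_iff[of "\<lambda>t. (norm (glob X (Suc t) \<omega> - glob X t \<omega>))\<^sup>2"] by simp
  qed
  moreover have loc: "AE \<omega> in W. summable (\<lambda>t. (norm (loc X (Suc t) k \<omega> - glob X t \<omega>))\<^sup>2)"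
    if k: "k \<in> {1..n_micro P}" for k
    using path
  proof eventually_elim
    case (elim \<omega>)
    then obtain N where "noise_bounded_path W P X \<omega> h m N" by blast
    then interpret noise_bounded_path W P X \<omega> h m N .
    show ?case using local_update_le[OF k] h by (rule geometric_square_summable)
  qed
  moreover have "AE \<omega> in W. (\<lambda>t. norm (glob X (Suc t) \<omega> - glob X t \<omega>)) \<longlonglongrightarrow> 0"
    using glob by eventually_elim (rule square_summable_tendsto_zero)
  moreover have "AE \<omega> in W. (\<lambda>t. norm (loc X (Suc t) k \<omega> - glob X t \<omega>)) \<longlonglongrightarrow> 0"
    if "k \<in> {1..n_micro P}" for k
    using loc[OF that] by eventually_elim (rule square_summable_tendsto_zero)
  ultimately show ?thesis by blast
qed

end
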